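(* Let $N,M\ge 1$ be integers. Let $(P_n)_{n\ge 0}$ and $(Q_n)_{n\ge 0}$ be two monic orthogonal polynomial sequences with respect to the regular linear functionals $\mathbf{u}$ and $\mathbf{v}$, respectively, normalized by $\langle \mathbf{u},1\rangle=1=\langle \mathbf{v},1\rangle$. Assume that they are related by $$P_n(x)+\sum_{i=1}^N r_{i,n}P_{n-i}(x)=Q_n(x)+\sum_{i=1}^M s_{i,n}Q_{n-i}(x),\qquad n\ge 0,$$ where the complex coefficients satisfy the initial conditions $$\det \mathbf{A}\neq 0,\qquad r_{N,N+M}\neq 0,\qquad s_{M,N+M}\neq 0,$$ with $\mathbf{A}$ the matrix defined in the context. Then the following properties hold: (a) All the coefficients $r_{N,n}$ and $s_{M,n}$ in the relation are nonzero, for every $n\ge N+M$. (b) There exist constant sequences $(\lambda_{i,n})_{n\ge N+M}$ and $(\mu_{i,n})_{n\ge N+M}$ such that $\lambda_{i,n}=\lambda_i$ for $i=0,\dots,N-1$ and $\mu_{i,n}=\mu_i$ for $i=0,\dots,M-1$, where $(\lambda_i)_{i=0}^{N-1}$ and $(\mu_i)_{i=0}^{M-1}$ are the coefficients which appear in the expressions $$\Psi_N(x)=r_{N,M+N}\,\overline{Q}_N(x)+\sum_{i=0}^{N-1}\lambda_i\,\overline{Q}_i(x),\qquad \Phi_M(x)=s_{M,M+N}\,\overline{P}_M(x)+\sum_{i=0}^{M-1}\mu_i\,\overline{P}_i(x)$$ of the polynomials $\Psi_N$ and $\Phi_M$ (described in the context) satisfying $\Phi_M\mathbf{u}=\Ps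i_N\mathbf{v}$.
   Context: All polynomials have complex coefficients, and linear functionals are complex linear functionals on the space of polynomials. For a functional $\mathbf{u}$ and polynomials $\phi,p$, the functional $\phi\mathbf{u}$ is defined by $\langle \phi\mathbf{u},p\rangle=\langle \mathbf{u},\phi p\rangle$. A monic orthogonal polynomial sequence with respect to $\mathbf{u}$ is a sequence of monic polynomials $P_n$ with $\deg P_n=n$, $\langle \mathbf{u},P_nP_m\rangle=0$ for $n\ne m$ and $\langle \mathbf{u},P_n^2\rangle\neq 0$ for all $n$; $\mathbf{u}$ is regular if such a sequence exists. Polynomials with negative index are zero. Notation: $\overline{P}_n=P_n/\langle \mathbf{u},P_n^2\rangle$ and $\overline{Q}_n=Q_n/\langle \mathbf{v},Q_n^2\rangle$. Matrix $\mathbf{A}$: put $R_n:=P_n+\sum_{i=1}^N r_{i,n}P_{n-i}=Q_n+\sum_{i=1}^M s_{i,n}Q_{n-i}$. The dual basis of a sequence $(S_n)_n$ of polynomials with $\deg S_n=n$ is the sequence of functionals $(\mathbf{d}_n)_n$ with $\langle \mathbf{d}_n,S_j\rangle=\delta_{n,j}$. Let $(\mathbf{c}_n)_n,(\mathbf{a}_n)_n,(\mathbf{b}_n)_n$ be the dual bases of $(R_n)_n,(P_n)_n,(Q_n)_n$. The $(M+N)\times(M+N)$ matrix $\mathbf{A}$ is defined by $\mathbf{A}(\mathbf{c}_0,\dots,\mathbf{c}_{M+N-1})^T=(\mathbf{a}_0,\dots,\mathbf{a}_{M-1},\mathbf{b}_0,\dots,\mathbf{b}_{N-1})^T$. Explicitly,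 numbering rows and columns from $0$ to $M+N-1$ and putting $r_{0,j}=s_{0,j}=1$: for $0\le i\le M-1$ the $(i,j)$ entry is $r_{j-i,j}$ if $i\le j\le i+N$ and $0$ otherwise; for $0\le k\le N-1$ the $(M+k,j)$ entry is $s_{j-k,j}$ if $k\le j\le k+M$ and $0$ otherwise. Polynomials $\Phi_M,\Psi_N$: under the initial conditions there is a unique pair of polynomials $\Phi_M,\Psi_N$, of exact degrees $M$ and $N$, of the form displayed in (b) (with leading terms $s_{M,M+N}\overline{P}_M$ and $r_{N,M+N}\overline{Q}_N$), such that $\Phi_M\mathbf{u}=\Psi_N\mathbf{v}$. *)

theory Defs
  imports "HOL-Computational_Algebra.Polynomial" "Jordan_Normal_Form.Determinant"
begin

type_synonym functional = "complex poly \<Rightarrow> complex"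

definition linear_functional :: "functional \<Rightarrow> bool" where
  "linear_functional u \<longleftrightarrow> Vector_Spaces.linear smult (*) u"

definition poly_mult_functional :: "complex poly \<Rightarrow> functional \<Rightarrow> functional"
    (infixr \<open>\<cdot>\<^sub>f\<close> 75) where
  "\<phi> \<cdot>\<^sub>f u = (\<lambda>p. u (\<phi> * p))"

definition monic_ops :: "functional \<Rightarrow> (nat \<Rightarrow> complex poly) \<Rightarrow> bool" where
  "monic_ops u P \<longleftrightarrow>
     (\<forall>n. degree (P n) = n \<and> lead_coeff (P n) = 1) \<and>
     (\<forall>n m. n \<noteq> m \<longrightarrow> u (P n * P m) = 0) \<and>
     (\<forall>n. u ((P n)\<^sup>2) \<noteq> 0)"

definition regular_functional :: "functional \<Rightarrow> bool" where
  "regular_functional u \<longleftrightarrow> linear_functional u \<and> (\<exists>P. monic_ops u P)"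

definition normalized :: "functional \<Rightarrow> (nat \<Rightarrow> complex poly) \<Rightarrow> nat \<Rightarrow> complex poly" where
  "normalized u P n = smult (1 / u ((P n)\<^sup>2)) (P n)"

text \<open>\<open>back_term P n i\<close> is \<open>P\<^bsub>n-i\<^esub>\<close> with the convention that polynomials with negative index vanish.\<close>

definition back_term :: "(nat \<Rightarrow> complex poly) \<Rightarrow> nat \<Rightarrow> nat \<Rightarrow> complex poly" where
  "back_term P n i = (if i \<le> n then P (n - i) else 0)"

text \<open>
  Coefficient families are written \<open>r i n\<close> for \<open>r\<^bsub>i,n\<^esub>\<close>. Only the values with \<open>i \<ge> 1\<close> are data;
  the convention \<open>r\<^bsub>0,n\<^esub> = 1\<close> is built into \<open>ext_coeff\<close>, whatever the value of \<open>r 0 n\<close>.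
\<close>

definition ext_coeff :: "(nat \<Rightarrow> nat \<Rightarrow> complex) \<Rightarrow> nat \<Rightarrow> nat \<Rightarrow> complex" where
  "ext_coeff r i n = (if i = 0 then 1 else r i n)"

text \<open>
  With \<open>R\<^bsub>n\<^esub>\<close> the common value of the two sides of the structure relation, row \<open>i < M\<close>
  (respectively \<open>M + k\<close>, \<open>k < N\<close>) lists the coordinates, in the dual basis of the \<open>R\<^bsub>n\<^esub>\<close>, of the
  \<open>i\<close>-th (\<open>k\<close>-th) element of the dual basis of the \<open>P\<^bsub>n\<^esub>\<close> (of the \<open>Q\<^bsub>n\<^esub>\<close>).
\<close>

definition structure_matrix ::
  "nat \<Rightarrow> nat \<Rightarrow> (nat \<Rightarrow> nat \<Rightarrow> complex) \<Rightarrow> (nat \<Rightarrow> nat \<Rightarrow> complex) \<Rightarrow> complex mat" where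
  "structure_matrix N M r s = mat (M + N) (M + N) (\<lambda>(i, j).
     if i < M then (if i \<le> j \<and> j \<le> i + N then ext_coeff r (j - i) j else 0)
     else (let k = i - M in if k \<le> j \<and> j \<le> k + M then ext_coeff s (j - k) j else 0))"

definition is_structure_pair ::
  "nat \<Rightarrow> nat \<Rightarrow> (nat \<Rightarrow> nat \<Rightarrow> complex) \<Rightarrow> (nat \<Rightarrow> nat \<Rightarrow> complex) \<Rightarrow>
   functional \<Rightarrow> (nat \<Rightarrow> complex poly) \<Rightarrow> functional \<Rightarrow> (nat \<Rightarrow> complex poly) \<Rightarrow>
   complex poly \<Rightarrow> complex poly \<Rightarrow> bool" where
  "is_structure_pair N M r s u P v Q \<Phi> \<Psi> \<longleftrightarrow>
     degree \<Phi> = M \<and> degree \<Psi> = N \<and>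
     (\<exists>mu. \<Phi> = smult (s M (M + N)) (normalized u P M) + (\<Sum>i<M. smult (mu i) (normalized u P i))) \<and>
     (\<exists>lam. \<Psi> = smult (r N (M + N)) (normalized v Q N) + (\<Sum>i<N. smult (lam i) (normalized v Q i))) \<and>
     \<Phi> \<cdot>\<^sub>f u = \<Psi> \<cdot>\<^sub>f v"

end

theory Submission
  imports Defs
begin

text \<open>
  Since the functionals \<open>normalized u P i \<cdot>\<^sub>f u\<close> form the dual basis of \<open>P\<close>, a relation
  \<open>\<rho> \<cdot>\<^sub>f u = \<sigma> \<cdot>\<^sub>f v\<close> amounts to a banded linear system for the coordinates of \<open>\<rho>\<close> and \<open>\<sigma>\<close>.
  Invertibility of the structure matrix yields the pair \<open>(\<Phi>, \<Psi>)\<close> and excludes relations with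
  \<open>deg \<rho> < M\<close> and \<open>deg \<sigma> < N\<close> except the trivial one. Every relation satisfies \<open>\<rho> \<Psi> = \<Phi> \<sigma>\<close>,
  hence \<open>deg \<rho> - deg \<sigma> = M - N\<close> unless it is trivial. If \<open>s M n = 0\<close> for some \<open>n \<ge> N + M\<close>, the
  system for \<open>deg \<rho> < M\<close>, \<open>deg \<sigma> \<le> n - M\<close> has \<open>n + 1\<close> unknowns but only \<open>n\<close> nontrivial equations,
  and a nonzero solution contradicts the degree balance. The case of \<open>r N n\<close> is symmetric.
\<close>

section \<open>Square linear systems and expansion in a graded polynomial basis\<close>

lemma sum_lessThan_add:
  fixes f :: "nat \<Rightarrow> 'a::comm_monoid_add"
  shows "(\<Sum>i<m + k. f i) = (\<Sum>i<m. f i) + (\<Sum>i<k. f (m + i))"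
  by (induction k) (simp_all add: add.assoc)

lemma mat_mult_vec_component:
  fixes f :: "nat \<times> nat \<Rightarrow> 'a::semiring_0"
  assumes "i < n"
  shows "(mat n n f *\<^sub>v vec n x) $ i = (\<Sum>j<n. f (i, j) * x j)"
  using assms by (simp add: scalar_prod_def lessThan_atLeast0)

text \<open>Invariance under transposition lets one array be read with the unknowns along its rows
  or along its columns.\<close>

lemma det_mat_swap:
  "det (mat n n (\<lambda>(i, j). f (j, i))) = det (mat n n f :: 'a::comm_ring_1 mat)"
proof -
  have "mat n n (\<lambda>(i, j). f (j, i)) = transpose_mat (mat n n f)"
    by (rule eq_matI) auto
  then show ?thesis
    by (simp add: det_transpose[of _ n])
qed

lemma det_mat_eq_0_iff:
  fixes f :: "nat \<times> nat \<Rightarrow> 'a::field"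
  shows "det (mat n n f) = 0 \<longleftrightarrow>
    (\<exists>x. (\<exists>j<n. x j \<noteq> 0) \<and> (\<forall>i<n. (\<Sum>j<n. f (i, j) * x j) = 0))"
proof -
  have "det (mat n n f) = 0 \<longleftrightarrow>
      (\<exists>v. v \<in> carrier_vec n \<and> v \<noteq> 0\<^sub>v n \<and> mat n n f *\<^sub>v v = 0\<^sub>v n)"
    by (rule det_0_iff_vec_prod_zero) simp
  also have "\<dots> \<longleftrightarrow> (\<exists>x. vec n x \<noteq> 0\<^sub>v n \<and> mat n n f *\<^sub>v vec n x = 0\<^sub>v n)"
    (is "?L \<longleftrightarrow> ?R")
  proof
    assume ?L
    then obtain v where v: "v \<in> carrier_vec n" "v \<noteq> 0\<^sub>v n" "mat n n f *\<^sub>v v = 0\<^sub>v n"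
      by blast
    moreover have "vec n (($) v) = v"
      using v(1) by auto
    ultimately show ?R
      by metis
  next
    assume ?R
    then show ?L
      by (meson vec_carrier)
  qed
  also have "\<dots> \<longleftrightarrow>
      (\<exists>x. (\<exists>j<n. x j \<noteq> 0) \<and> (\<forall>i<n. (\<Sum>j<n. f (i, j) * x j) = 0))"
  proof (rule ex_cong1)
    fix x :: "nat \<Rightarrow> 'a"
    have "vec n x = 0\<^sub>v n \<longleftrightarrow> (\<forall>j<n. x j = 0)"
      by (auto simp: vec_eq_iff)
    moreover have "mat n n f *\<^sub>v vec n x = 0\<^sub>v n \<longleftrightarrow> (\<forall>i<n. (\<Sum>j<n. f (i, j) * x j) = 0)"
      by (auto simp: vec_eq_iff mat_mult_vec_component simp del: index_mult_mat_vec)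
    ultimately show "vec n x \<noteq> 0\<^sub>v n \<and> mat n n f *\<^sub>v vec n x = 0\<^sub>v n \<longleftrightarrow>
        (\<exists>j<n. x j \<noteq> 0) \<and> (\<forall>i<n. (\<Sum>j<n. f (i, j) * x j) = 0)"
      by blast
  qed
  finally show ?thesis .
qed

text \<open>The adjugate gives the solution: \<open>A * adj_mat A\<close> is \<open>det A\<close>
  times the identity, so only a division by the determinant remains.\<close>

lemma det_mat_solve:
  fixes f :: "nat \<times> nat \<Rightarrow> 'a::field"
  assumes "det (mat n n f) \<noteq> 0"
  shows "\<exists>x. \<forall>i<n. (\<Sum>j<n. f (i, j) * x j) = b i"
proof -
  define A where "A = mat n n f"
  define y where "y = adj_mat A *\<^sub>v vec n b"
  define d where "d = det A"
  have A: "A \<in> carrier_mat n n" and adj: "adj_mat A \<in> carrier_mat n n"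
    by (simp_all add: A_def adj_mat)
  have y: "y \<in> carrier_vec n"
    using adj by (simp add: y_def)
  have "A *\<^sub>v y = (A * adj_mat A) *\<^sub>v vec n b"
    unfolding y_def by (rule assoc_mult_mat_vec[symmetric, OF A adj]) simp
  also have "\<dots> = d \<cdot>\<^sub>v vec n b"
    by (rule eq_vecI) (simp_all add: adj_mat(2)[OF A] d_def)
  finally have eq: "A *\<^sub>v y = d \<cdot>\<^sub>v vec n b" .
  have yv: "vec n (($) y) = y"
    using y by auto
  have "(\<Sum>j<n. f (i, j) * (y $ j / d)) = b i" if "i < n" for i
  proof -
    have "(\<Sum>j<n. f (i, j) * (y $ j / d)) = (\<Sum>j<n. f (i, j) * y $ j) / d"
      by (simp add: sum_divide_distrib)
    also have "(\<Sum>j<n. f (i, j) * y $ j) = (A *\<^sub>v y) $ i"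
      by (rule mat_mult_vec_component[OF that, of f "($) y", unfolded yv, folded A_def, symmetric])
    also have "\<dots> = d * b i"
      using that by (simp add: eq)
    finally show ?thesis
      using assms by (simp add: d_def A_def)
  qed
  then show ?thesis
    by (intro exI[of _ "\<lambda>j. y $ j / d"] allI impI)
qed

text \<open>Induction on \<open>n\<close>: a multiple of \<open>B n\<close> removes the coefficient
  of index \<open>n\<close> and leaves a polynomial covered by the induction hypothesis.\<close>

lemma poly_expansion:
  fixes B :: "nat \<Rightarrow> 'a::field poly"
  assumes deg: "\<And>j. degree (B j) = j" and nonzero: "\<And>j. B j \<noteq> 0"
    and "\<And>i. i \<ge> n \<Longrightarrow> coeff q i = 0"
  shows "\<exists>c. q = (\<Sum>i<n. smult (c i) (B i))"
  using assms(3)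
proof (induction n arbitrary: q)
  case 0
  then have "q = 0"
    by (simp add: poly_eq_iff)
  then show ?case
    by simp
next
  case (Suc n)
  define a where "a = coeff q n / coeff (B n) n"
  have "coeff (B n) n \<noteq> 0"
    using nonzero[of n] deg[of n] by (metis leading_coeff_0_iff)
  then have "coeff (q - smult a (B n)) i = 0" if "i \<ge> n" for i
    using that Suc.prems[of i] deg[of n]
    by (cases "i = n") (simp_all add: a_def coeff_eq_0)
  then obtain c where "q - smult a (B n) = (\<Sum>i<n. smult (c i) (B i))"
    using Suc.IH by blast
  then have "q = (\<Sum>i<Suc n. smult ((c(n := a)) i) (B i))"
    by (simp add: algebra_simps)
  then show ?case
    by blast
qed

text \<open>
  \<open>band K r i j\<close> is the value of the \<open>i\<close>-th dual functional of \<open>P\<close> at the polynomial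
  \<open>P j + \<Sum>m=1..K. r m j P (j - m)\<close>, see \<open>dual_structure\<close>.
\<close>

definition band :: "nat \<Rightarrow> (nat \<Rightarrow> nat \<Rightarrow> complex) \<Rightarrow> nat \<Rightarrow> nat \<Rightarrow> complex" where
  "band K r i j = (if i \<le> j \<and> j \<le> i + K then ext_coeff r (j - i) j else 0)"

lemma band_eq_0: "i + K < j \<Longrightarrow> band K r i j = 0"
  by (simp add: band_def)

lemma band_last: "K \<ge> 1 \<Longrightarrow> band K r i (i + K) = r K (i + K)"
  by (simp add: band_def ext_coeff_def)

lemma structure_matrix_band:
  "structure_matrix N M r s =
    mat (M + N) (M + N) (\<lambda>(i, j). if i < M then band N r i j else band M s (i - M) j)"
  by (rule eq_matI) (auto simp: structure_matrix_def band_def Let_def)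

section \<open>A single orthogonal sequence and its dual basis\<close>

locale orthogonal_sequence =
  fixes u :: functional and P :: "nat \<Rightarrow> complex poly"
  assumes linear: "linear_functional u" and ops: "monic_ops u P"
begin

lemma degree_P [simp]: "degree (P n) = n"
  and lead_P: "coeff (P n) n = 1"
  and orthogonal: "n \<noteq> m \<Longrightarrow> u (P n * P m) = 0"
  and norm_nonzero: "u ((P n)\<^sup>2) \<noteq> 0"
  using ops unfolding monic_ops_def by metis+

lemma P_nonzero [simp]: "P n \<noteq> 0"
  using lead_P[of n] by auto

lemma functional_add: "u (p + q) = u p + u q"
  and functional_scale: "u (smult c p) = c * u p"
  using linear unfolding linear_functional_def Vector_Spaces.linear_iff by blast+

lemma functional_0 [simp]: "u 0 = 0"
  using functional_scale[of 0 0] by simp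

lemma functional_diff: "u (p - q) = u p - u q"
  using functional_add[of p "smult (-1) q"] functional_scale[of "-1" q] by simp

lemma functional_sum: "u (\<Sum>i\<in>A. f i) = (\<Sum>i\<in>A. u (f i))"
  by (induction A rule: infinite_finite_induct) (simp_all add: functional_add)

lemma degree_normalized [simp]: "degree (normalized u P n) = n"
  using norm_nonzero by (simp add: normalized_def)

lemma dual_basis: "u (normalized u P i * P j) = (if i = j then 1 else 0)"
  using norm_nonzero[of i] orthogonal[of i j]
  by (cases "i = j") (simp_all add: normalized_def functional_scale power2_eq_square)

text \<open>Duality leaves at most one contribution: \<open>P j\<close> itself if
  \<open>i = j\<close>, otherwise the summand \<open>m = j - i\<close>, provided it lies in the
  range.\<close>

lemma dual_structure:
  "u (normalized u P i * (P j + (\<Sum>m=1..K. smult (r m j) (back_term P j m)))) = band K r i j"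
proof -
  have "u (normalized u P i * (P j + (\<Sum>m=1..K. smult (r m j) (back_term P j m)))) =
      (if i = j then 1 else 0) + (\<Sum>m=1..K. if m = j - i \<and> i \<le> j then r m j else 0)"
  proof -
    have "u (normalized u P i * back_term P j m) = (if m = j - i \<and> i \<le> j then 1 else 0)"
      if "m \<ge> 1" for m
      using that by (auto simp: back_term_def dual_basis)
    then have "(\<Sum>m=1..K. r m j * u (normalized u P i * back_term P j m)) =
        (\<Sum>m=1..K. if m = j - i \<and> i \<le> j then r m j else 0)"
      by (intro sum.cong) auto
    then show ?thesis
      by (simp add: distrib_left functional_add sum_distrib_left functional_sum
          functional_scale dual_basis)
  qed
  also have "\<dots> = band K r i j"
    by (cases "i \<le> j") (auto simp: band_def ext_coeff_def sum.delta)
  finally show ?thesis .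
qed

lemma degree_combination:
  assumes "m \<ge> 1"
  shows "degree (\<Sum>i<m. smult (f i) (normalized u P i)) < m"
proof -
  have "degree (\<Sum>i<m. smult (f i) (normalized u P i)) \<le> m - 1"
    by (rule degree_sum_le) (auto intro: order.trans[OF degree_smult_le])
  with assms show ?thesis
    by simp
qed

lemma combination_coeff:
  "u ((\<Sum>i<m. smult (f i) (normalized u P i)) * P j) = (if j < m then f j else 0)"
proof -
  have "u ((\<Sum>i<m. smult (f i) (normalized u P i)) * P j) = (\<Sum>i<m. if i = j then f i else 0)"
    by (simp add: sum_distrib_right functional_sum functional_scale dual_basis
        if_distrib[of "\<lambda>x. _ * x"] cong: if_cong)
  then show ?thesis
    by simp
qed

lemma combination_eq_0D:
  assumes "(\<Sum>i<m. smult (f i) (normalized u P i)) = 0" "j < m"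
  shows "f j = 0"
  using combination_coeff[of f m j] assms by simp

lemma normalized_expansion:
  assumes "degree p < n"
  shows "\<exists>c. p = (\<Sum>i<n. smult (c i) (normalized u P i))"
proof (rule poly_expansion)
  show "normalized u P j \<noteq> 0" for j
    using norm_nonzero by (simp add: normalized_def)
  show "coeff p i = 0" if "i \<ge> n" for i
    using assms that by (simp add: coeff_eq_0)
qed simp

text \<open>Pairing \<open>p - q\<close> with each \<open>P j\<close> reads off its coordinate along
  \<open>normalized u P j\<close>, and every such pairing vanishes.\<close>

lemma regular_cancel:
  assumes "p \<cdot>\<^sub>f u = q \<cdot>\<^sub>f u"
  shows "p = q"
proof -
  define d where "d = p - q"
  obtain c where c: "d = (\<Sum>i<Suc (degree d). smult (c i) (normalized u P i))"
    using normalized_expansion by blast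
  have "u (d * P j) = 0" for j
    using fun_cong[OF assms, of "P j"]
    by (simp add: d_def poly_mult_functional_def left_diff_distrib functional_diff)
  then have "c j = 0" if "j < Suc (degree d)" for j
    using combination_coeff[of c "Suc (degree d)" j] that c by metis
  then have "d = 0"
    by (subst c) simp
  then show ?thesis
    by (simp add: d_def)
qed

lemma combination_structure:
  "u ((\<Sum>i<m. smult (f i) (normalized u P i)) *
      (P j + (\<Sum>l=1..K. smult (r l j) (back_term P j l)))) = (\<Sum>i<m. f i * band K r i j)"
  by (simp only: sum_distrib_right functional_sum functional_scale mult_smult_left dual_structure)

end

section \<open>Two sequences linked by the structure relation\<close>

locale related_sequences =
  u: orthogonal_sequence u P + v: orthogonal_sequence v Q
  for N M :: nat and u P v Q and r s :: "nat \<Rightarrow> nat \<Rightarrow> complex" +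
  assumes N: "N \<ge> 1" and M: "M \<ge> 1"
    and structure_relation: "\<And>n. P n + (\<Sum>i=1..N. smult (r i n) (back_term P n i)) =
      Q n + (\<Sum>i=1..M. smult (s i n) (back_term Q n i))"
begin

text \<open>Symmetry of the setting, so that a result about \<open>s\<close> also yields its
  counterpart for \<open>r\<close>.\<close>

lemma swap: "related_sequences M N v Q u P s r"
  by unfold_locales (fact N M structure_relation[symmetric])+

definition R :: "nat \<Rightarrow> complex poly" where
  "R n = P n + (\<Sum>i=1..N. smult (r i n) (back_term P n i))"

text \<open>The correction terms start at \<open>i = 1\<close> and have degree below
  \<open>n\<close>, so \<open>R n\<close> is monic and the \<open>R n\<close> form a basis of the
  polynomials.\<close>

lemma degree_R: "degree (R n) = n" and R_nonzero: "R n \<noteq> 0"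
proof -
  define t where "t = (\<Sum>i=1..N. smult (r i n) (back_term P n i))"
  have t: "coeff t k = 0" if "k \<ge> n" for k
  proof -
    have "coeff (back_term P n i) k = 0" if "i \<in> {1..N}" for i
      using that \<open>k \<ge> n\<close> by (auto simp: back_term_def intro!: coeff_eq_0)
    then show ?thesis
      by (simp add: t_def coeff_sum)
  qed
  have lead: "coeff (R n) n = 1" and upper: "\<And>k. k > n \<Longrightarrow> coeff (R n) k = 0"
    unfolding R_def t_def[symmetric] using t by (simp_all add: u.lead_P coeff_eq_0)
  show "degree (R n) = n"
    using lead upper by (intro antisym degree_le le_degree) simp_all
  show "R n \<noteq> 0"
    using lead by auto
qed

lemma relation_iff_R:
  "\<rho> \<cdot>\<^sub>f u = \<sigma> \<cdot>\<^sub>f v \<longleftrightarrow> (\<forall>j. u (\<rho> * R j) = v (\<sigma> * R j))"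
proof
  assume eq: "\<forall>j. u (\<rho> * R j) = v (\<sigma> * R j)"
  show "\<rho> \<cdot>\<^sub>f u = \<sigma> \<cdot>\<^sub>f v"
  proof
    fix p
    obtain c where p: "p = (\<Sum>i<Suc (degree p). smult (c i) (R i))"
      using poly_expansion[of R "Suc (degree p)" p] degree_R R_nonzero
      by (auto simp: coeff_eq_0)
    have "u (\<rho> * p) = v (\<sigma> * p)"
      by (subst (1 2) p) (simp only: sum_distrib_left mult_smult_right u.functional_sum
          v.functional_sum u.functional_scale v.functional_scale eq)
    then show "(\<rho> \<cdot>\<^sub>f u) p = (\<sigma> \<cdot>\<^sub>f v) p"
      by (simp add: poly_mult_functional_def)
  qed
qed (metis poly_mult_functional_def)

text \<open>Testing on the basis \<open>R j\<close> suffices. The left side uses its expression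
  through \<open>P\<close>, the right side the one through \<open>Q\<close>, so each pairing becomes
  a banded sum.\<close>

lemma relation_iff_band:
  "(\<Sum>i<m. smult (f i) (normalized u P i)) \<cdot>\<^sub>f u = (\<Sum>k<l. smult (g k) (normalized v Q k)) \<cdot>\<^sub>f v \<longleftrightarrow>
    (\<forall>j. (\<Sum>i<m. f i * band N r i j) = (\<Sum>k<l. g k * band M s k j))"
proof -
  have "u ((\<Sum>i<m. smult (f i) (normalized u P i)) * R j) = (\<Sum>i<m. f i * band N r i j)" for j
    by (simp only: R_def u.combination_structure)
  moreover have "v ((\<Sum>k<l. smult (g k) (normalized v Q k)) * R j) =
      (\<Sum>k<l. g k * band M s k j)" for j
    by (simp only: R_def structure_relation v.combination_structure)
  ultimately show ?thesis
    by (simp only: relation_iff_R)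
qed

text \<open>The equations with \<open>j < M + N\<close> say that the transposed structure matrix
  annihilates the coordinates of \<open>\<rho>\<close> joined to those of
  \<open>-\<sigma>\<close>.\<close>

lemma trivial_relation:
  assumes det: "det (structure_matrix N M r s) \<noteq> 0"
    and deg: "degree \<rho> < M" "degree \<sigma> < N" and rel: "\<rho> \<cdot>\<^sub>f u = \<sigma> \<cdot>\<^sub>f v"
  shows "\<rho> = 0 \<and> \<sigma> = 0"
proof -
  obtain f g where f: "\<rho> = (\<Sum>i<M. smult (f i) (normalized u P i))"
    and g: "\<sigma> = (\<Sum>k<N. smult (g k) (normalized v Q k))"
    using u.normalized_expansion[OF deg(1)] v.normalized_expansion[OF deg(2)] by blast
  have eq: "(\<Sum>i<M. f i * band N r i j) = (\<Sum>k<N. g k * band M s k j)" for j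
    using rel unfolding f g relation_iff_band by blast
  define x where "x i = (if i < M then f i else - g (i - M))" for i
  define A where "A = (\<lambda>(i, j). if i < M then band N r i j else band M s (i - M) j)"
  have "(\<Sum>i<M + N. A (i, j) * x i) = 0" for j
    using eq[of j] by (simp add: sum_lessThan_add A_def x_def sum_negf mult.commute)
  moreover have "det (mat (M + N) (M + N) (\<lambda>(j, i). A (i, j))) \<noteq> 0"
    using det unfolding det_mat_swap A_def structure_matrix_band .
  ultimately have x: "x i = 0" if "i < M + N" for i
    using that unfolding det_mat_eq_0_iff by auto
  have "f i = 0" if "i < M" for i
    using x[of i] that by (simp add: x_def)
  moreover have "g k = 0" if "k < N" for k
    using x[of "M + k"] that by (simp add: x_def)
  ultimately show ?thesis
    by (simp add: f g)
qed

text \<open>With the leading coefficients prescribed, \<open>M + N\<close> unknowns remain. The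
  equations with \<open>j < M + N\<close> determine them, and the later ones hold
  automatically.\<close>

lemma structure_pair_exists:
  assumes det: "det (structure_matrix N M r s) \<noteq> 0"
    and lead: "r N (N + M) \<noteq> 0" "s M (N + M) \<noteq> 0"
  shows "\<exists>\<Phi> \<Psi>. is_structure_pair N M r s u P v Q \<Phi> \<Psi>"
proof -
  define A where "A = (\<lambda>(i, j). if i < M then band N r i j else band M s (i - M) j)"
  \<comment> \<open>The contributions of the two prescribed leading terms, moved to the right-hand
    side.\<close>
  define b where "b j = r N (M + N) * band M s N j - s M (M + N) * band N r M j" for j
  have "det (mat (M + N) (M + N) (\<lambda>(j, i). A (i, j))) \<noteq> 0"
    using det unfolding det_mat_swap A_def structure_matrix_band .
  then obtain x where x: "(\<Sum>i<M + N. A (i, j) * x i) = b j" if "j < M + N" for j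
    using det_mat_solve[of "M + N" "\<lambda>(j, i). A (i, j)" b] by auto
  \<comment> \<open>The overwritten value \<open>x M\<close> belongs to the second block;
    \<open>g\<close> still takes it from \<open>x\<close>.\<close>
  define f where "f = x(M := s M (M + N))"
  define g where "g k = (if k < N then - x (M + k) else r N (M + N))" for k
  define \<Phi> where "\<Phi> = (\<Sum>i<Suc M. smult (f i) (normalized u P i))"
  define \<Psi> where "\<Psi> = (\<Sum>k<Suc N. smult (g k) (normalized v Q k))"
  have "(\<Sum>i<Suc M. f i * band N r i j) = (\<Sum>k<Suc N. g k * band M s k j)" for j
  proof -
    consider "j < M + N" | "j = M + N" | "j > M + N"
      by linarith
    then show ?thesis
    proof cases
      case 1
      from x[OF this] show ?thesis
        by (simp add: sum_lessThan_add A_def f_def g_def b_def sum_negf algebra_simps)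
    next
      \<comment> \<open>Only the leading terms reach this equation, and both sides equal
        \<open>r N (M + N) * s M (M + N)\<close>.\<close>
      case 2
      then show ?thesis
        using band_last[OF N, of r M] band_last[OF M, of s N]
        by (simp add: band_eq_0 f_def g_def add.commute)
    next
      case 3
      then show ?thesis
        by (simp add: band_eq_0)
    qed
  qed
  then have "\<Phi> \<cdot>\<^sub>f u = \<Psi> \<cdot>\<^sub>f v"
    unfolding \<Phi>_def \<Psi>_def relation_iff_band by blast
  moreover have \<Phi>: "\<Phi> = smult (s M (M + N)) (normalized u P M) +
      (\<Sum>i<M. smult (x i) (normalized u P i))"
    by (simp add: \<Phi>_def f_def)
  moreover have \<Psi>: "\<Psi> = smult (r N (M + N)) (normalized v Q N) +
      (\<Sum>i<N. smult (g i) (normalized v Q i))"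
    by (simp add: \<Psi>_def g_def)
  moreover have "degree \<Phi> = M" unfolding \<Phi>
    using u.degree_combination[OF M, of x] lead(2)
    by (simp add: degree_add_eq_left add.commute)
  moreover have "degree \<Psi> = N" unfolding \<Psi>
    using v.degree_combination[OF N, of g] lead(1)
    by (simp add: degree_add_eq_left add.commute)
  ultimately show ?thesis
    unfolding is_structure_pair_def by blast
qed

text \<open>Equal leading terms cancel, so the differences satisfy a relation of lower degrees, to
  which \<open>trivial_relation\<close> applies.\<close>

lemma structure_pair_unique:
  assumes det: "det (structure_matrix N M r s) \<noteq> 0"
    and pair: "is_structure_pair N M r s u P v Q \<Phi> \<Psi>"
    and pair': "is_structure_pair N M r s u P v Q \<Phi>' \<Psi>'"
  shows "\<Phi>' = \<Phi> \<and> \<Psi>' = \<Psi>"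
proof -
  obtain mu where
    "\<Phi> = smult (s M (M + N)) (normalized u P M) + (\<Sum>i<M. smult (mu i) (normalized u P i))"
    using pair unfolding is_structure_pair_def by blast
  moreover obtain mu' where
    "\<Phi>' = smult (s M (M + N)) (normalized u P M) + (\<Sum>i<M. smult (mu' i) (normalized u P i))"
    using pair' unfolding is_structure_pair_def by blast
  ultimately have "\<Phi>' - \<Phi> = (\<Sum>i<M. smult (mu' i - mu i) (normalized u P i))"
    by (simp add: sum_subtractf smult_diff_left)
  then have "degree (\<Phi>' - \<Phi>) < M"
    by (simp only: u.degree_combination[OF M])
  obtain lam where
    "\<Psi> = smult (r N (M + N)) (normalized v Q N) + (\<Sum>i<N. smult (lam i) (normalized v Q i))"
    using pair unfolding is_structure_pair_def by blast
  moreover obtain lam' where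
    "\<Psi>' = smult (r N (M + N)) (normalized v Q N) + (\<Sum>i<N. smult (lam' i) (normalized v Q i))"
    using pair' unfolding is_structure_pair_def by blast
  ultimately have "\<Psi>' - \<Psi> = (\<Sum>i<N. smult (lam' i - lam i) (normalized v Q i))"
    by (simp add: sum_subtractf smult_diff_left)
  then have "degree (\<Psi>' - \<Psi>) < N"
    by (simp only: v.degree_combination[OF N])
  moreover have "(\<Phi>' - \<Phi>) \<cdot>\<^sub>f u = (\<Psi>' - \<Psi>) \<cdot>\<^sub>f v"
    using pair pair' unfolding is_structure_pair_def poly_mult_functional_def
    by (simp add: left_diff_distrib u.functional_diff v.functional_diff fun_eq_iff)
  ultimately show ?thesis
    using trivial_relation[OF det] \<open>degree (\<Phi>' - \<Phi>) < M\<close> by fastforce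
qed

text \<open>Both products multiply \<open>v\<close> to the same functional, namely
  \<open>\<rho> * \<Phi>\<close> times \<open>u\<close>; regularity of \<open>v\<close> cancels
  it.\<close>

lemma relation_proportional:
  assumes rel: "\<rho> \<cdot>\<^sub>f u = \<sigma> \<cdot>\<^sub>f v" and rel': "\<Phi> \<cdot>\<^sub>f u = \<Psi> \<cdot>\<^sub>f v"
  shows "\<rho> * \<Psi> = \<Phi> * \<sigma>"
proof (rule v.regular_cancel, rule ext)
  fix p
  have "v (\<rho> * \<Psi> * p) = u (\<Phi> * (\<rho> * p))"
    using fun_cong[OF rel', of "\<rho> * p"] by (simp add: poly_mult_functional_def ac_simps)
  also have "\<dots> = v (\<Phi> * \<sigma> * p)"
    using fun_cong[OF rel, of "\<Phi> * p"] by (simp add: poly_mult_functional_def ac_simps)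
  finally show "((\<rho> * \<Psi>) \<cdot>\<^sub>f v) p = ((\<Phi> * \<sigma>) \<cdot>\<^sub>f v) p"
    by (simp add: poly_mult_functional_def)
qed

text \<open>Assuming \<open>trivial\<close> instead of a nonzero determinant allows use with the two
  sequences exchanged, without rearranging the structure matrix.\<close>

lemma last_coeff_nonzero:
  assumes trivial: "\<And>\<rho> \<sigma>. degree \<rho> < M \<Longrightarrow> degree \<sigma> < N \<Longrightarrow> \<rho> \<cdot>\<^sub>f u = \<sigma> \<cdot>\<^sub>f v \<Longrightarrow>
      \<rho> = 0 \<and> \<sigma> = 0"
    and rel: "\<Phi> \<cdot>\<^sub>f u = \<Psi> \<cdot>\<^sub>f v" and deg: "degree \<Phi> = M" "degree \<Psi> = N"
    and n: "n \<ge> N + M"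
  shows "s M n \<noteq> 0"
proof
  assume s0: "s M n = 0"
  define A where "A = (\<lambda>(j, i). if i < M then band N r i j else - band M s (i - M) j)"
  define l where "l = Suc n - M"
  have l: "Suc n = M + l" "l \<ge> 1"
    using n N by (auto simp: l_def)
  \<comment> \<open>Equation \<open>n\<close> lies beyond the bands of all unknowns except the last,
    whose entry is \<open>- s M n\<close>.\<close>
  have row_n: "A (n, i) = 0" if "i < Suc n" for i
  proof (cases "i = n")
    case True
    have "band M s (n - M) n = 0"
      using band_last[OF M, of s "n - M"] s0 n by simp
    with True n N show ?thesis
      by (simp add: A_def)
  next
    case False
    with that n show ?thesis
      by (auto simp: A_def intro!: band_eq_0)
  qed
  \<comment> \<open>Row \<open>n\<close> of \<open>A\<close> is zero, so the transposed matrix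
    annihilates the unit vector of index \<open>n\<close>.\<close>
  have "det (mat (Suc n) (Suc n) (\<lambda>(i, j). A (j, i))) = 0"
    unfolding det_mat_eq_0_iff
    by (rule exI[of _ "\<lambda>j. if j = n then 1 else 0"])
      (auto simp: row_n if_distrib[of "\<lambda>x. _ * x"] cong: if_cong)
  then have "det (mat (Suc n) (Suc n) A) = 0"
    by (simp add: det_mat_swap)
  then obtain x where x: "\<exists>i<Suc n. x i \<noteq> 0"
    and solution: "\<And>j. j < Suc n \<Longrightarrow> (\<Sum>i<Suc n. A (j, i) * x i) = 0"
    unfolding det_mat_eq_0_iff by blast
  define g where "g k = x (M + k)" for k
  define \<rho> where "\<rho> = (\<Sum>i<M. smult (x i) (normalized u P i))"
  define \<sigma> where "\<sigma> = (\<Sum>k<l. smult (g k) (normalized v Q k))"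
  have "(\<Sum>i<M. x i * band N r i j) = (\<Sum>k<l. g k * band M s k j)" for j
  proof (cases "j < Suc n")
    case True
    from solution[OF this] show ?thesis
      unfolding l by (simp add: sum_lessThan_add A_def g_def sum_negf mult.commute)
  next
    \<comment> \<open>For \<open>j > n\<close> every band has ended, since \<open>i + N < j\<close>
      for \<open>i < M\<close> and \<open>k + M \<le> n\<close> for \<open>k < l\<close>.\<close>
    case False
    with l n show ?thesis
      by (simp add: band_eq_0)
  qed
  then have rel\<rho>: "\<rho> \<cdot>\<^sub>f u = \<sigma> \<cdot>\<^sub>f v"
    unfolding \<rho>_def \<sigma>_def relation_iff_band by blast
  then have proportional: "\<rho> * \<Psi> = \<Phi> * \<sigma>"
    using rel by (rule relation_proportional)
  have "degree \<rho> < M"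
    unfolding \<rho>_def by (rule u.degree_combination[OF M])
  \<comment> \<open>Comparing degrees in \<open>\<rho> * \<Psi> = \<Phi> * \<sigma>\<close> improves
    the a priori bound \<open>n - M\<close> to one where \<open>trivial\<close> applies.\<close>
  have "degree \<sigma> < N"
  proof (cases "\<sigma> = 0")
    case False
    then have "\<rho> \<noteq> 0"
      using proportional deg M by auto
    then have "degree \<rho> + N = M + degree \<sigma>"
      using proportional deg False M N by (metis degree_0 degree_mult_eq not_one_le_zero)
    with \<open>degree \<rho> < M\<close> show ?thesis
      by linarith
  qed (use N in simp)
  then have "\<rho> = 0" "\<sigma> = 0"
    using trivial[OF \<open>degree \<rho> < M\<close> _ rel\<rho>] by blast+
  have "x i = 0" if "i < Suc n" for i
  proof (cases "i < M")
    case True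
    then show ?thesis
      using u.combination_eq_0D \<open>\<rho> = 0\<close> unfolding \<rho>_def by blast
  next
    case False
    then have "g (i - M) = 0"
      using v.combination_eq_0D[of g l "i - M"] \<open>\<sigma> = 0\<close> that l unfolding \<sigma>_def by simp
    with False show ?thesis
      by (simp add: g_def)
  qed
  with x show False
    by blast
qed

end

theorem theorem2p3:
  fixes N M :: nat
    and P Q :: "nat \<Rightarrow> complex poly"
    and u v :: "complex poly \<Rightarrow> complex"
    and r s :: "nat \<Rightarrow> nat \<Rightarrow> complex"
  assumes "N \<ge> 1" and "M \<ge> 1"
    and "regular_functional u" and "regular_functional v"
    and "monic_ops u P" and "monic_ops v Q"
    and "u 1 = 1" and "v 1 = 1"
    and "\<And>n. P n + (\<Sum>i=1..N. smult (r i n) (back_term P n i))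
            = Q n + (\<Sum>i=1..M. smult (s i n) (back_term Q n i))"
    and "det (structure_matrix N M r s) \<noteq> 0"
    and "r N (N + M) \<noteq> 0" and "s M (N + M) \<noteq> 0"
  shows "(\<forall>n\<ge>N + M. r N n \<noteq> 0 \<and> s M n \<noteq> 0) \<and>
    (\<exists>\<Phi> \<Psi>.
       (\<forall>\<Phi>' \<Psi>'. is_structure_pair N M r s u P v Q \<Phi>' \<Psi>' \<longleftrightarrow> \<Phi>' = \<Phi> \<and> \<Psi>' = \<Psi>) \<and>
       (\<exists>(lamseq :: nat \<Rightarrow> nat \<Rightarrow> complex) (museq :: nat \<Rightarrow> nat \<Rightarrow> complex)
         (lam :: nat \<Rightarrow> complex) (mu :: nat \<Rightarrow> complex).
          \<Psi> = smult (r N (M + N)) (normalized v Q N) + (\<Sum>i<N. smult (lam i) (normalized v Q i)) \<and>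
          \<Phi> = smult (s M (M + N)) (normalized u P M) + (\<Sum>i<M. smult (mu i) (normalized u P i)) \<and>
          (\<forall>n\<ge>N + M. (\<forall>i<N. lamseq i n = lam i) \<and> (\<forall>i<M. museq i n = mu i))))"
proof -
  interpret related_sequences N M u P v Q r s
    using assms by unfold_locales (auto simp: regular_functional_def)
  interpret swapped: related_sequences M N v Q u P s r
    by (rule swap)
  obtain \<Phi> \<Psi> where pair: "is_structure_pair N M r s u P v Q \<Phi> \<Psi>"
    using structure_pair_exists assms by blast
  have deg: "degree \<Phi> = M" "degree \<Psi> = N" and rel: "\<Phi> \<cdot>\<^sub>f u = \<Psi> \<cdot>\<^sub>f v"
    using pair by (simp_all add: is_structure_pair_def)
  have "s M n \<noteq> 0" if "n \<ge> N + M" for n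
    using last_coeff_nonzero[OF _ rel deg that] trivial_relation assms by blast
  moreover have "r N n \<noteq> 0" if "n \<ge> N + M" for n
  \<comment> \<open>With the roles exchanged, \<open>r N n\<close> is the last coefficient and the
    pair is read as \<open>(\<Psi>, \<Phi>)\<close>.\<close>
  proof (rule swapped.last_coeff_nonzero[OF _ rel[symmetric] deg(2) deg(1)])
    show "M + N \<le> n"
      using that by simp
    show "\<rho> = 0 \<and> \<sigma> = 0"
      if "degree \<rho> < N" "degree \<sigma> < M" "\<rho> \<cdot>\<^sub>f v = \<sigma> \<cdot>\<^sub>f u" for \<rho> \<sigma>
      using trivial_relation[of \<sigma> \<rho>] that assms by simp
  qed
  moreover have "is_structure_pair N M r s u P v Q \<Phi>' \<Psi>' \<longleftrightarrow> \<Phi>' = \<Phi> \<and> \<Psi>' = \<Psi>" for \<Phi>' \<Psi>'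
    using structure_pair_unique[OF _ pair] pair assms by blast
  moreover obtain lam mu where
    "\<Psi> = smult (r N (M + N)) (normalized v Q N) + (\<Sum>i<N. smult (lam i) (normalized v Q i))"
    "\<Phi> = smult (s M (M + N)) (normalized u P M) + (\<Sum>i<M. smult (mu i) (normalized u P i))"
    using pair unfolding is_structure_pair_def by blast
  ultimately show ?thesis
    \<comment> \<open>The sequences of (b) repeat, for every \<open>n\<close>, the lower
      coefficients of the unique pair.\<close>
    by (intro conjI exI[of _ \<Phi>] exI[of _ \<Psi>] exI[of _ "\<lambda>i n. lam i"] exI[of _ "\<lambda>i n. mu i"]
        exI[of _ lam] exI[of _ mu]) auto
qed

end
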